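(* Let $\Lambda:\mathbb{R}^N\to\mathbb{R}^N$ be a non-singular affine map and let $A$ be the $N\times N$ matrix of the linear part of $\Lambda$. For $\theta\in(0,1)$ let $R=\theta^{-N/(N+1)}$, and for every $k\in\mathbb{N}^+$ let $$U_k=\Big\{\Lambda\big(\tfrac{\mathbf{p}}{q}\big): q\in\mathbb{N}^+,\ \mathbf{p}\in\mathbb{Z}^N,\ R^{k-1}\le q<R^k\Big\}.$$ Let $V_N$ be the volume of the $N$-dimensional unit ball. Then for every $r>0$ with $r^N<|\det A|\,(N!)^{-1}V_N^{-1}\theta^N$, for every $k\in\mathbb{N}^+$ and every $\mathbf{x}\in\mathbb{R}^N$, there exists an affine hyperplane $\mathcal{L}$ such that $U_k\cap B(\mathbf{x},\theta^{k-1}r)\subset\mathcal{L}$.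
   Context: $B(\mathbf{x},r)$ denotes the closed Euclidean ball of radius $r$ centered at $\mathbf{x}$; $\mathbb{N}^+$ is the set of strictly positive integers. *)

theory Defs
  imports "HOL-Analysis.Analysis"
begin

definition affine_hyperplane_set :: "'a::euclidean_space set \<Rightarrow> bool" where
  "affine_hyperplane_set L \<longleftrightarrow> (\<exists>a b. a \<noteq> 0 \<and> L = {y. a \<bullet> y = b})"

definition rational_point :: "int ^ 'n \<Rightarrow> nat \<Rightarrow> real ^ 'n::finite" where
  "rational_point p q = (\<chi> i. real_of_int (p $ i) / real q)"

text \<open>
  The pair \<open>(p, q)\<close> is not required to be in lowest terms, so a point may occur in
  \<open>rational_layer \<Lambda> R k\<close> for several values of \<open>k\<close>. The layers are indexed from \<open>k = 1\<close>;
  for \<open>k = 0\<close> the subtraction truncates and the value has no meaning.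
\<close>
definition rational_layer ::
    "(real ^ 'n \<Rightarrow> real ^ 'n) \<Rightarrow> real \<Rightarrow> nat \<Rightarrow> (real ^ 'n::finite) set" where
  "rational_layer \<Lambda> R k =
     {\<Lambda> (rational_point p q) | p q. 0 < q \<and> R ^ (k - 1) \<le> real q \<and> real q < R ^ k}"

end

theory Submission
  imports Defs
begin

text \<open>
  Suppose the points of the layer in the ball lie in no hyperplane. Then \<open>N + 1\<close> of them,
  \<open>\<Lambda> (p\<^sub>j / q\<^sub>j)\<close>, are vertices of a nondegenerate simplex. With \<open>D\<close> the determinant of the
  differences \<open>p\<^sub>j / q\<^sub>j - p\<^sub>0 / q\<^sub>0\<close>, the number \<open>q\<^sub>0 \<cdots> q\<^sub>N D\<close> is a nonzero integer, so
  \<open>\<bar>D\<bar> > R\<close> to the power \<open>-k (N + 1)\<close>, which is \<open>\<theta>\<close> to the power \<open>k N\<close>.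
  On the other hand, with \<open>s\<close> the radius of the ball, Hadamard's inequality gives
  \<open>\<bar>det A\<bar> \<bar>D\<bar> \<le> (2 s)\<^sup>N\<close>, and \<open>2\<^sup>N \<le> N! V\<^sub>N\<close> (the unit ball contains the cross-polytope, of
  volume \<open>2\<^sup>N / N!\<close>). This contradicts the bound on \<open>r\<close>.
\<close>

subsection \<open>Hadamard's inequality\<close>

lemma linear_det_row:
  fixes M :: "real ^ 'n ^ 'n"
  shows "linear (\<lambda>y. det (\<chi> k. if k = i then y else M $ k))"
proof (rule linearI)
  show "det (\<chi> k. if k = i then x + y else M $ k) =
      det (\<chi> k. if k = i then x else M $ k) + det (\<chi> k. if k = i then y else M $ k)" for x y
    using det_row_add[of i "\<lambda>_. x" "\<lambda>_. y" "\<lambda>k. M $ k"] by simp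
  show "det (\<chi> k. if k = i then r *\<^sub>R x else M $ k) =
      r *\<^sub>R det (\<chi> k. if k = i then x else M $ k)" for r x
    using det_row_mul[of i r "\<lambda>_. x" "\<lambda>k. M $ k"] unfolding scalar_mult_eq_scaleR by simp
qed

text \<open>Ensures that the maximum of \<open>\<bar>det M\<bar>\<close> in Hadamard's inequality is
  attained.\<close>

lemma compact_rows_in_unit_ball: "compact {M :: real ^ 'n ^ 'm. \<forall>i. norm (M $ i) \<le> 1}"
proof -
  have "norm M \<le> real CARD('m)" if "\<forall>i. norm (M $ i) \<le> 1" for M :: "real ^ 'n ^ 'm"
  proof -
    have "norm M \<le> (\<Sum>i\<in>UNIV. norm (M $ i))"
      unfolding norm_vec_def[of M] by (rule L2_set_le_sum) simp
    also have "\<dots> \<le> (\<Sum>i\<in>(UNIV :: 'm set). 1)"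
      using that by (intro sum_mono) auto
    finally show ?thesis by simp
  qed
  then have "bounded {M :: real ^ 'n ^ 'm. \<forall>i. norm (M $ i) \<le> 1}"
    unfolding bounded_iff by blast
  moreover have "closed {M :: real ^ 'n ^ 'm. \<forall>i. norm (M $ i) \<le> 1}"
    by (intro closed_Collect_all closed_Collect_le continuous_intros)
  ultimately show ?thesis by (simp add: compact_eq_bounded_closed)
qed

text \<open>
  At a maximum of \<open>\<bar>det\<bar>\<close> over matrices with rows in the unit ball, the determinant as a function
  of the \<open>i\<close>-th row is the inner product with a multiple of that row. It vanishes at the other
  rows, so the maximizer is orthogonal.
\<close>
lemma abs_det_le_1:
  fixes M :: "real ^ 'n ^ 'n"
  assumes "\<And>i. norm (M $ i) \<le> 1"
  shows "\<bar>det M\<bar> \<le> 1"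
proof -
  define K where "K = {M :: real ^ 'n ^ 'n. \<forall>i. norm (M $ i) \<le> 1}"
  have "continuous_on K (\<lambda>M. \<bar>det M\<bar>)"
    unfolding det_def by (intro continuous_intros)
  moreover have "compact K" "M \<in> K"
    using assms by (auto simp: K_def compact_rows_in_unit_ball)
  ultimately obtain P where P: "P \<in> K" and max: "\<And>Q. Q \<in> K \<Longrightarrow> \<bar>det Q\<bar> \<le> \<bar>det P\<bar>"
    using continuous_attains_sup[of K "\<lambda>M. \<bar>det M\<bar>"] by blast
  show ?thesis
  proof (cases "det P = 0")
    case True
    then show ?thesis using max[OF \<open>M \<in> K\<close>] by simp
  next
    case False
    have rows: "P $ i \<bullet> P $ i = 1 \<and> (\<forall>j. j \<noteq> i \<longrightarrow> P $ i \<bullet> P $ j = 0)" for i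
    proof -
      define g where "g y = det (\<chi> k. if k = i then y else P $ k)" for y
      interpret g: linear g
        unfolding g_def by (rule linear_det_row)
      \<comment> \<open>\<open>adjoint g 1\<close> is the Riesz representative of the linear
        functional \<open>g\<close>.\<close>
      define w where "w = adjoint g 1"
      have w: "g y = w \<bullet> y" for y
        using adjoint_works[OF g.linear_axioms, of y 1] by (simp add: w_def inner_commute)
      have "(\<chi> k. if k = i then P $ i else P $ k) = P"
        by (auto simp: vec_eq_iff)
      then have gP: "w \<bullet> P $ i = det P"
        by (simp add: w[symmetric] g_def)
      have bound: "\<bar>w \<bullet> y\<bar> \<le> \<bar>det P\<bar>" if "norm y \<le> 1" for y
        using that P max by (auto simp: w[symmetric] g_def K_def)
      have "w \<noteq> 0" using gP False by auto
      \<comment> \<open>Test \<open>bound\<close> at the unit vector in the direction of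
        \<open>w\<close>.\<close>
      have "norm w \<le> \<bar>det P\<bar>"
        using bound[of "w /\<^sub>R norm w"] \<open>w \<noteq> 0\<close>
        by (simp add: dot_square_norm power2_eq_square field_simps)
      have Pi: "norm (P $ i) \<le> 1" using P by (simp add: K_def)
      have sq: "(norm w)\<^sup>2 \<le> (det P)\<^sup>2" "P $ i \<bullet> P $ i \<le> 1"
        using \<open>norm w \<le> \<bar>det P\<bar>\<close> Pi
        by (auto simp: abs_le_square_iff[symmetric] dot_square_norm abs_square_le_1)
      \<comment> \<open>This is the equality case of Cauchy-Schwarz: the norm bounds on
        \<open>w\<close> and \<open>P $ i\<close>, together with \<open>gP\<close>, force the
        difference to vanish.\<close>
      have "(norm (w - det P *\<^sub>R P $ i))\<^sup>2 =
          (norm w)\<^sup>2 - 2 * (det P)\<^sup>2 + (det P)\<^sup>2 * (P $ i \<bullet> P $ i)"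
        using gP inner_commute[of "P $ i" w] unfolding power2_norm_eq_inner
        by (simp add: power2_eq_square algebra_simps)
      moreover have "(det P)\<^sup>2 * (P $ i \<bullet> P $ i) \<le> (det P)\<^sup>2"
        using sq(2) by (simp add: mult_left_le)
      ultimately have "(norm (w - det P *\<^sub>R P $ i))\<^sup>2 \<le> 0"
        using sq(1) by linarith
      then have w_eq: "w = det P *\<^sub>R P $ i" by simp
      have "P $ i \<bullet> P $ i = 1"
        using gP False by (simp add: w_eq)
      moreover have "P $ i \<bullet> P $ j = 0" if "j \<noteq> i" for j
      proof -
        have "g (P $ j) = 0"
          unfolding g_def using that by (intro det_identical_rows[of i j]) (auto simp: row_def vec_eq_iff)
        then show ?thesis using w[of "P $ j"] False by (simp add: w_eq)
      qed
      ultimately show ?thesis by blast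
    qed
    then have "orthogonal_matrix P"
      unfolding orthogonal_matrix_orthonormal_rows
      by (auto simp: row_def orthogonal_def norm_eq_1)
    then have "\<bar>det P\<bar> = 1" using det_orthogonal_matrix by fastforce
    then show ?thesis using max[OF \<open>M \<in> K\<close>] by simp
  qed
qed

corollary abs_det_le_power:
  fixes M :: "real ^ 'n ^ 'n"
  assumes "\<And>i. norm (M $ i) \<le> s" "0 < s"
  shows "\<bar>det M\<bar> \<le> s ^ CARD('n)"
proof -
  define M' where "M' = (\<chi> i. M $ i /\<^sub>R s)"
  have "M = (\<chi> i. s *s M' $ i)"
    using assms(2) by (simp add: M'_def vec_eq_iff)
  then have "det M = s ^ CARD('n) * det M'"
    using det_rows_mul[of "\<lambda>_. s" "\<lambda>i. M' $ i"] by simp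
  moreover have "\<bar>det M'\<bar> \<le> 1"
    using assms by (intro abs_det_le_1) (simp add: M'_def divide_simps)
  ultimately show ?thesis
    using assms(2) by (simp add: abs_mult mult_left_le)
qed

subsection \<open>Volume of the unit ball\<close>

lemma unit_ball_vol_plus_2:
  assumes "0 \<le> n"
  shows "unit_ball_vol (n + 2) = 2 * pi / (n + 2) * unit_ball_vol n"
proof -
  have "Gamma ((n + 2) / 2 + 1) = (n + 2) / 2 * Gamma (n / 2 + 1)"
  proof -
    have "n / 2 + 1 \<notin> \<int>\<^sub>\<le>\<^sub>0"
      using assms nonpos_Ints_nonpos[of "n / 2 + 1"] by auto
    from Gamma_plus1[OF this] show ?thesis by (simp add: add_divide_distrib)
  qed
  moreover have "pi powr ((n + 2) / 2) = pi * pi powr (n / 2)"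
    by (simp add: add_divide_distrib powr_add)
  ultimately show ?thesis
    by (simp only: unit_ball_vol_def) simp
qed

text \<open>From \<open>n\<close> to \<open>n + 2\<close> the left side grows by the factor 4 and
  the right side by \<open>2 * pi * (n + 1)\<close>, which is at least 4. Equality holds for
  \<open>n = 0\<close> and \<open>n = 1\<close>.\<close>

lemma two_power_le_fact_unit_ball_vol: "2 ^ n \<le> fact n * unit_ball_vol (real n)"
proof (induction n rule: induct_nat_012)
  case (ge2 n)
  have "2 ^ Suc (Suc n) = 4 * 1 * (2 ^ n :: real)" by simp
  also have "\<dots> \<le> (2 * pi) * (real n + 1) * (fact n * unit_ball_vol (real n))"
    using pi_ge_two by (intro mult_mono ge2) auto
  also have "\<dots> = fact (Suc (Suc n)) * (2 * pi / (real n + 2) * unit_ball_vol (real n))"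
    by (simp add: field_simps)
  also have "\<dots> = fact (Suc (Suc n)) * unit_ball_vol (real (Suc (Suc n)))"
    using unit_ball_vol_plus_2[of "real n"] by (simp add: add.commute)
  finally show ?case .
qed auto

subsection \<open>Simplices with rational vertices\<close>

lemma det_in_Ints:
  fixes M :: "'a::comm_ring_1 ^ 'n ^ 'n"
  assumes "\<And>i j. M $ i $ j \<in> \<int>"
  shows "det M \<in> \<int>"
  unfolding det_def using assms by (intro Ints_sum Ints_mult Ints_prod) auto

text \<open>Since \<open>i \<notin> S\<close>, row \<open>i\<close> stays intact, and the
  subtractions can be made one row at a time.\<close>

lemma det_sub_multiples_of_row:
  fixes M :: "real ^ 'n ^ 'n"
  assumes "finite S" "i \<notin> S"
  shows "det (\<chi> j. if j \<in> S then M $ j - c j *s M $ i else M $ j) = det M"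
  using assms
proof (induction S rule: finite_induct)
  case empty
  then show ?case by (simp add: vec_lambda_eta)
next
  case (insert k S)
  define P where "P = (\<chi> j. if j \<in> S then M $ j - c j *s M $ i else M $ j)"
  have "row i P \<in> vec.span {row j P |j. j \<noteq> k}"
    using insert.prems by (intro vec.span_base) auto
  then have "- c k *s row i P \<in> vec.span {row j P |j. j \<noteq> k}"
    by (rule vec.span_scale)
  from det_row_span[OF this]
  have "det (\<chi> j. if j = k then row k P + - c k *s row i P else row j P) = det P" .
  also have "(\<chi> j. if j = k then row k P + - c k *s row i P else row j P) =
      (\<chi> j. if j \<in> insert k S then M $ j - c j *s M $ i else M $ j)"
    using insert by (auto simp: vec_eq_iff P_def row_def)
  finally show ?case using insert by (simp add: P_def)
qed

text \<open>
  By multilinearity, \<open>det (p\<^sub>j - c\<^sub>j v)\<close> is \<open>det (p\<^sub>j)\<close> minus the sum over \<open>i\<close> of \<open>c\<^sub>i\<close> times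
  \<open>det (p\<^sub>j)\<close> with row \<open>i\<close> replaced by \<open>v\<close>; the terms with two rows \<open>v\<close> vanish.
\<close>
lemma det_sub_multiples_in_Ints:
  fixes M :: "real ^ 'n ^ 'n" and v :: "real ^ 'n"
  assumes "finite S"
    and M: "\<And>i j. M $ i $ j \<in> \<int>" and v: "\<And>j. v $ j \<in> \<int>"
    and m: "m \<in> \<int>" and c: "\<And>i. m * c i \<in> \<int>"
  shows "m * det (\<chi> j. if j \<in> S then M $ j - c j *s v else M $ j) \<in> \<int>"
  using assms(1)
proof (induction S rule: finite_induct)
  case empty
  then show ?case using det_in_Ints[OF M] m by (simp add: vec_lambda_eta)
next
  case (insert k S)
  define P where "P = (\<chi> j. if j \<in> S then M $ j - c j *s v else M $ j)"
  define Q where "Q = (\<chi> j. if j = k then v else M $ j)"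
  interpret g: linear "\<lambda>y. det (\<chi> j. if j = k then y else P $ j)"
    by (rule linear_det_row)
  have "(\<chi> j. if j \<in> insert k S then M $ j - c j *s v else M $ j) =
      (\<chi> j. if j = k then M $ k - c k *s v else P $ j)"
    by (auto simp: vec_eq_iff P_def)
  then have "det (\<chi> j. if j \<in> insert k S then M $ j - c j *s v else M $ j) =
      det (\<chi> j. if j = k then M $ k else P $ j) - c k * det (\<chi> j. if j = k then v else P $ j)"
    using g.diff[of "M $ k" "c k *\<^sub>R v"] g.scale[of "c k" v] by (simp only: scalar_mult_eq_scaleR) simp
  also have "(\<chi> j. if j = k then M $ k else P $ j) = P"
    using insert by (auto simp: vec_eq_iff P_def)
  \<comment> \<open>Row \<open>k\<close> of \<open>Q\<close> is \<open>v\<close>, so the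
    subtractions of \<open>v\<close> are row operations on \<open>Q\<close>.\<close>
  also have "(\<chi> j. if j = k then v else P $ j) =
      (\<chi> j. if j \<in> S then Q $ j - c j *s Q $ k else Q $ j)"
    using insert by (auto simp: vec_eq_iff P_def Q_def)
  also have "det \<dots> = det Q"
    using insert by (intro det_sub_multiples_of_row) auto
  finally have "m * det (\<chi> j. if j \<in> insert k S then M $ j - c j *s v else M $ j) =
      m * det P - (m * c k) * det Q"
    by (simp only: right_diff_distrib mult.assoc)
  moreover have "det Q \<in> \<int>"
    using M v by (intro det_in_Ints) (auto simp: Q_def)
  ultimately show ?case
    using insert.IH c by (simp add: P_def Ints_diff Ints_mult)
qed

text \<open>Scaling row \<open>i\<close> by \<open>q i\<close> leaves integer rows minus multiples
  of the single vector \<open>p0\<close>, with coefficients of denominator \<open>q0\<close>. Hence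
  one factor \<open>q0\<close> suffices instead of one per row.\<close>

lemma det_rational_differences_in_Ints:
  fixes p :: "'n::finite \<Rightarrow> int ^ 'n" and p0 :: "int ^ 'n"
  assumes "0 < q0" "\<And>i. 0 < q i"
  shows "real q0 * (\<Prod>i\<in>UNIV. real (q i)) *
    det (\<chi> i. rational_point (p i) (q i) - rational_point p0 q0) \<in> \<int>"
proof -
  define c where "c i = real (q i) / real q0" for i
  define M where "M = (\<chi> i j. real_of_int (p i $ j))"
  define v where "v = (\<chi> j. real_of_int (p0 $ j))"
  have "real q0 * det (\<chi> j. if j \<in> UNIV then M $ j - c j *s v else M $ j) \<in> \<int>"
    using assms by (intro det_sub_multiples_in_Ints) (auto simp: M_def v_def c_def)
  moreover have "(\<chi> j. if j \<in> UNIV then M $ j - c j *s v else M $ j) =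
      (\<chi> i. real (q i) *s (rational_point (p i) (q i) - rational_point p0 q0))"
    using assms by (simp add: vec_eq_iff M_def v_def c_def rational_point_def field_simps)
  ultimately show ?thesis
    by (simp only: det_rows_mul mult.assoc)
qed

text \<open>Translate a point of \<open>S\<close> to the origin. If the differences do not span, a
  vector orthogonal to them is the normal of a hyperplane; otherwise a basis chosen among them gives
  the simplex.\<close>

lemma hyperplane_or_simplex:
  fixes S :: "(real ^ 'n) set"
  obtains L where "affine_hyperplane_set L" "S \<subseteq> L"
  | y0 f where "y0 \<in> S" "\<And>i. f i \<in> S" "det (\<chi> i :: 'n. f i - y0) \<noteq> 0"
proof (cases "S = {}")
  case True
  have "affine_hyperplane_set {y :: real ^ 'n. 1 \<bullet> y = 0}"
    unfolding affine_hyperplane_set_def by (intro exI[of _ 1] exI[of _ 0]) simp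
  then show ?thesis using True that(1) by blast
next
  case False
  then obtain y0 where "y0 \<in> S" by blast
  define T where "T = (\<lambda>y. y - y0) ` S"
  show ?thesis
  proof (cases "span T = UNIV")
    case False
    then obtain a where "a \<noteq> 0" and a: "\<And>x. x \<in> span T \<Longrightarrow> a \<bullet> x = 0"
      using span_not_UNIV_orthogonal by blast
    have "a \<bullet> y = a \<bullet> y0" if "y \<in> S" for y
      using a[of "y - y0"] that by (auto simp: T_def span_base inner_diff_right)
    then show ?thesis
      using that(1)[of "{y. a \<bullet> y = a \<bullet> y0}"] \<open>a \<noteq> 0\<close>
      unfolding affine_hyperplane_set_def by blast
  next
    case True
    obtain B where B: "B \<subseteq> T" "independent B" "T \<subseteq> span B" "card B = dim T"
      using basis_exists by blast
    have span: "span B = UNIV"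
      using B(3) True span_mono span_span by blast
    have "dim T = CARD('n)"
      using True by (metis dim_span dim_UNIV DIM_cart DIM_real mult.right_neutral)
    then obtain f :: "'n \<Rightarrow> real ^ 'n" where f: "bij_betw f UNIV B"
      using B(4) independent_imp_finite[OF B(2)] finite_same_card_bij[of "UNIV :: 'n set" B] by auto
    have "rows (\<chi> i. f i) = B"
      using f by (auto simp: rows_def row_def bij_betw_def vec_lambda_eta)
    then have "det (\<chi> i. f i) \<noteq> 0"
      using span matrix_left_invertible_span_rows[of "\<chi> i. f i"]
      by (simp add: invertible_det_nz[symmetric] invertible_left_inverse)
    moreover have "f i + y0 \<in> S" for i
    proof -
      have "f i \<in> T" using f B(1) by (auto simp: bij_betw_def)
      then show ?thesis by (auto simp: T_def)
    qed
    ultimately show ?thesis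
      using that(2)[of y0 "\<lambda>i. f i + y0"] \<open>y0 \<in> S\<close> by simp
  qed
qed

theorem theorem4p1:
  fixes \<Lambda> :: "real ^ 'n::finite \<Rightarrow> real ^ 'n"
    and A :: "real ^ 'n ^ 'n" and c :: "real ^ 'n"
    and \<theta> R r :: real and k :: nat and x :: "real ^ 'n"
  assumes affine_map: "\<And>y. \<Lambda> y = A *v y + c"
    and nonsingular: "invertible A"
    and theta: "0 < \<theta>" "\<theta> < 1"
    and R_eq: "R = \<theta> powr (- (real CARD('n) / (real CARD('n) + 1)))"
    and r_pos: "r > 0"
    and r_bound: "r ^ CARD('n) <
          \<bar>det A\<bar> * inverse (fact CARD('n)) * inverse (measure lborel (cball (0 :: real ^ 'n) 1))
            * \<theta> ^ CARD('n)"
    and k_pos: "k \<ge> 1"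
  shows "\<exists>L. affine_hyperplane_set L \<and>
           rational_layer \<Lambda> R k \<inter> cball x (\<theta> ^ (k - 1) * r) \<subseteq> L"
proof -
  define N where "N = CARD('n)"
  define s where "s = \<theta> ^ (k - 1) * r"
  define S where "S = rational_layer \<Lambda> R k \<inter> cball x s"
  have "s > 0" using theta r_pos by (simp add: s_def)
  have "R > 0" using theta by (simp add: R_eq)
  \<comment> \<open>The exponent in \<open>R\<close> is chosen so that \<open>N + 1\<close>
    denominators below \<open>R ^ k\<close> have product at most
    \<open>inverse (\<theta> ^ (k * N))\<close>.\<close>
  have "R ^ (N + 1) = R powr real (N + 1)"
    using \<open>R > 0\<close> by (subst powr_realpow) auto
  also have "\<dots> = \<theta> powr - real N"
    by (simp add: R_eq powr_powr N_def add.commute)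
  also have "\<dots> = inverse (\<theta> ^ N)"
    using theta by (simp add: powr_minus powr_realpow)
  finally have R_pow: "R ^ (N + 1) = inverse (\<theta> ^ N)" .
  show ?thesis
  proof (cases rule: hyperplane_or_simplex[of S])
    case (1 L)
    then show ?thesis by (auto simp: S_def s_def)
  next
    case (2 y0 f)
    from 2(1) obtain p0 q0 where q0: "0 < q0" "real q0 < R ^ k"
      and y0: "y0 = \<Lambda> (rational_point p0 q0)"
      by (auto simp: S_def rational_layer_def)
    have "\<exists>p q. 0 < q \<and> real q < R ^ k \<and> f i = \<Lambda> (rational_point p q)" for i
      using 2(2)[of i] by (auto simp: S_def rational_layer_def)
    then obtain p q where q: "\<And>i. 0 < q i" "\<And>i. real (q i) < R ^ k"
      and f: "\<And>i. f i = \<Lambda> (rational_point (p i) (q i))"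
      by metis
    define W where "W = (\<chi> i. rational_point (p i) (q i) - rational_point p0 q0)"
    \<comment> \<open>The translation \<open>c\<close> cancels; as the points are rows,
      \<open>A\<close> acts by its transpose from the right.\<close>
    have "(\<chi> i. f i - y0) = W ** transpose A"
      by (simp add: vec_eq_iff f y0 affine_map W_def matrix_matrix_mult_def transpose_def
          matrix_vector_mult_def sum_subtractf[symmetric] algebra_simps)
    then have det_eq: "det (\<chi> i. f i - y0) = det W * det A"
      by (simp add: det_mul)
    with 2(3) have "det W \<noteq> 0" by auto

    define Q where "Q = real q0 * (\<Prod>i\<in>UNIV. real (q i))"
    have "Q > 0" using q0 q by (simp add: Q_def prod_pos)
    have "Q * det W \<in> \<int>"
      unfolding Q_def W_def using q0 q by (intro det_rational_differences_in_Ints)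
    then have "1 \<le> \<bar>Q * det W\<bar>"
      using \<open>Q > 0\<close> \<open>det W \<noteq> 0\<close> by (intro Ints_nonzero_abs_ge1) auto
    also have "\<dots> = Q * \<bar>det W\<bar>"
      using \<open>Q > 0\<close> by (simp add: abs_mult)
    also have "\<dots> \<le> inverse (\<theta> ^ (k * N)) * \<bar>det W\<bar>"
    proof (rule mult_right_mono)
      have "(\<Prod>i\<in>(UNIV :: 'n set). real (q i)) \<le> (\<Prod>i\<in>(UNIV :: 'n set). R ^ k)"
        using q by (intro prod_mono) (auto intro: less_imp_le)
      then have "Q \<le> R ^ k * (R ^ k) ^ N"
        using q0 \<open>R > 0\<close> unfolding Q_def N_def by (intro mult_mono prod_nonneg) auto
      also have "\<dots> = (R ^ (N + 1)) ^ k"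
        by (simp add: power_mult[symmetric] power_add[symmetric] algebra_simps)
      also have "\<dots> = inverse (\<theta> ^ (k * N))"
        by (simp only: R_pow power_inverse power_mult[symmetric] mult.commute)
      finally show "Q \<le> inverse (\<theta> ^ (k * N))" .
    qed simp
    finally have lower: "\<theta> ^ (k * N) \<le> \<bar>det W\<bar>"
      using theta by (simp add: field_simps)

    have "norm (f i - y0) \<le> 2 * s" for i
      using 2(1) 2(2)[of i] dist_triangle2[of "f i" y0 x]
      by (simp add: S_def dist_norm[symmetric] dist_commute)
    then have "\<bar>det (\<chi> i. f i - y0)\<bar> \<le> (2 * s) ^ N"
      unfolding N_def using \<open>s > 0\<close> by (intro abs_det_le_power) auto
    then have "\<bar>det A\<bar> * \<bar>det W\<bar> \<le> (2 * s) ^ N"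
      by (simp add: det_eq abs_mult mult.commute)
    with mult_left_mono[OF lower, of "\<bar>det A\<bar>"]
    have "\<bar>det A\<bar> * \<theta> ^ (k * N) \<le> 2 ^ N * s ^ N"
      by (simp add: power_mult_distrib)
    \<comment> \<open>Trade the power of 2 from the diameter for the constant in
      \<open>r_bound\<close>.\<close>
    also have "\<dots> \<le> (fact N * unit_ball_vol (real N)) * s ^ N"
      using \<open>s > 0\<close> two_power_le_fact_unit_ball_vol by (intro mult_right_mono) auto
    also have "\<dots> = (fact N * unit_ball_vol (real N) * r ^ N) * \<theta> ^ ((k - 1) * N)"
      by (simp add: s_def power_mult_distrib power_mult)
    also have "\<dots> < (\<bar>det A\<bar> * \<theta> ^ N) * \<theta> ^ ((k - 1) * N)"
    proof (rule mult_strict_right_mono)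
      have "measure lborel (cball (0 :: real ^ 'n) 1) = unit_ball_vol (real N)"
        by (simp add: content_cball N_def)
      moreover have "unit_ball_vol (real N) > 0" by simp
      ultimately show "fact N * unit_ball_vol (real N) * r ^ N < \<bar>det A\<bar> * \<theta> ^ N"
        using r_bound by (simp add: N_def[symmetric] field_simps)
    qed (use theta in simp)
    \<comment> \<open>With \<open>k \<ge> 1\<close> the subtraction does not truncate, and the chain
      returns to its starting value with a strict inequality.\<close>
    also have "\<dots> = \<bar>det A\<bar> * \<theta> ^ (k * N)"
      using k_pos by (cases k) (auto simp: power_add)
    finally show ?thesis by simp
  qed
qed

end
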